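(* For every formula $\varphi\in\mathcal{L}_{K,\Box,B}$, the formula $B\varphi\leftrightarrow K\Diamond\Box\varphi$ is provable in $\mathsf{SEL}_{K,\Box,B}$.
   Context: Language. Fix a countable set PROP of primitive propositions. $\mathcal{L}_{K,\Box,B}$ is generated by $\varphi ::= p \mid \neg\varphi \mid \varphi\wedge\psi \mid K\varphi\mid\Box\varphi\mid B\varphi$, $p\in$ PROP. The connectives $\vee,\to,\leftrightarrow$ are defined as usual and $\Diamond := \neg\Box\neg$. The logic $\mathsf{EL}_{K,\Box}$ is the Hilbert system consisting of classical propositional logic (with modus ponens) plus: the $\mathsf{S5}$ principles for $K$: $K(\varphi\to\psi)\to(K\varphi\to K\psi)$, $K\varphi\to\varphi$, $K\varphi\to KK\varphi$, $\neg K\varphi\to K\neg K\varphi$, and the rule "from $\vdash\varphi$ infer $\vdash K\varphi$"; the $\mathsf{S4}$ principles for $\Box$: $\Box(\varphi\to\psi)\to(\Box\varphi\to\Box\psi)$, $\Box\varphi\to\varphi$, $\Box\varphi\to\Box\Box\varphi$, and the rule "from $\vdash\varphi$ infer $\vdash\Box\varphi$"; the scheme $(\mathrm{KI})$ $K\varphi\to\Box\varphi$. The logic $\mathsf{SEL}_{K,\Box,B}$ is $\mathsf{EL}_{K,\Box}$ (all schemes and rules now ranging over formulas of $\mathcal{L}_{K,\Box,B}$) plus the axiom schemes: $(\mathrm{K}_B)$ $B(\varphi\to\psi)\to(B\varphi\to B\psi)$; $(\mathrm{sPI})$ $B\varphi\to KB\varphi$; $(\mathrm{KB})$ $K\varphi\to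 B\varphi$; $(\mathrm{RB})$ $B\varphi\to B\Box\varphi$; $(\mathrm{wF})$ $B\varphi\to\Diamond\varphi$; $(\mathrm{CB})$ $B(\Box\varphi\vee\Box\neg\Box\varphi)$. *)

theory Defs
  imports "HOL-Library.Countable"
begin

datatype 'p fm =
    Pro 'p
  | Neg "'p fm" (\<open>\<^bold>\<not> _\<close> [70] 70)
  | Con "'p fm" "'p fm" (infixr \<open>\<^bold>\<and>\<close> 65)
  | Know "'p fm" (\<open>\<^bold>K _\<close> [70] 70)
  | Box "'p fm" (\<open>\<^bold>\<box> _\<close> [70] 70)
  | Bel "'p fm" (\<open>\<^bold>B _\<close> [70] 70)

abbreviation Dis :: "'p fm \<Rightarrow> 'p fm \<Rightarrow> 'p fm" (infixr \<open>\<^bold>\<or>\<close> 60) where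
  "\<phi> \<^bold>\<or> \<psi> \<equiv> \<^bold>\<not> (\<^bold>\<not> \<phi> \<^bold>\<and> \<^bold>\<not> \<psi>)"

abbreviation Imp :: "'p fm \<Rightarrow> 'p fm \<Rightarrow> 'p fm" (infixr \<open>\<^bold>\<longrightarrow>\<close> 55) where
  "\<phi> \<^bold>\<longrightarrow> \<psi> \<equiv> \<^bold>\<not> (\<phi> \<^bold>\<and> \<^bold>\<not> \<psi>)"

abbreviation Iff :: "'p fm \<Rightarrow> 'p fm \<Rightarrow> 'p fm" (infix \<open>\<^bold>\<longleftrightarrow>\<close> 50) where
  "\<phi> \<^bold>\<longleftrightarrow> \<psi> \<equiv> (\<phi> \<^bold>\<longrightarrow> \<psi>) \<^bold>\<and> (\<psi> \<^bold>\<longrightarrow> \<phi>)"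

abbreviation Dia :: "'p fm \<Rightarrow> 'p fm" (\<open>\<^bold>\<diamond> _\<close> [70] 70) where
  "\<^bold>\<diamond> \<phi> \<equiv> \<^bold>\<not> \<^bold>\<box> \<^bold>\<not> \<phi>"

(* Truth-functional evaluation: primitive propositions and modal formulas are
   treated as atoms, whose truth values are given by the arbitrary function v. *)
primrec tval :: "('p fm \<Rightarrow> bool) \<Rightarrow> 'p fm \<Rightarrow> bool" where
  "tval v (Pro p) = v (Pro p)"
| "tval v (\<^bold>\<not> \<phi>) = (\<not> tval v \<phi>)"
| "tval v (\<phi> \<^bold>\<and> \<psi>) = (tval v \<phi> \<and> tval v \<psi>)"
| "tval v (\<^bold>K \<phi>) = v (\<^bold>K \<phi>)"
| "tval v (\<^bold>\<box> \<phi>) = v (\<^bold>\<box> \<phi>)"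
| "tval v (\<^bold>B \<phi>) = v (\<^bold>B \<phi>)"

(* The substitution instances, in the full language, of classical tautologies. *)
definition tautology :: "'p fm \<Rightarrow> bool" where
  "tautology \<phi> \<longleftrightarrow> (\<forall>v. tval v \<phi>)"

(* Classical propositional logic is given by all tautologies together with modus ponens. *)
inductive SEL :: "'p fm \<Rightarrow> bool" (\<open>\<turnstile> _\<close> [50] 50) where
  Taut: "tautology \<phi> \<Longrightarrow> \<turnstile> \<phi>"
| MP: "\<turnstile> \<phi> \<Longrightarrow> \<turnstile> \<phi> \<^bold>\<longrightarrow> \<psi> \<Longrightarrow> \<turnstile> \<psi>"
| K_K: "\<turnstile> \<^bold>K (\<phi> \<^bold>\<longrightarrow> \<psi>) \<^bold>\<longrightarrow> (\<^bold>K \<phi> \<^bold>\<longrightarrow> \<^bold>K \<psi>)"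
| T_K: "\<turnstile> \<^bold>K \<phi> \<^bold>\<longrightarrow> \<phi>"
| Four_K: "\<turnstile> \<^bold>K \<phi> \<^bold>\<longrightarrow> \<^bold>K \<^bold>K \<phi>"
| Five_K: "\<turnstile> \<^bold>\<not> \<^bold>K \<phi> \<^bold>\<longrightarrow> \<^bold>K \<^bold>\<not> \<^bold>K \<phi>"
| Nec_K: "\<turnstile> \<phi> \<Longrightarrow> \<turnstile> \<^bold>K \<phi>"
| K_Box: "\<turnstile> \<^bold>\<box> (\<phi> \<^bold>\<longrightarrow> \<psi>) \<^bold>\<longrightarrow> (\<^bold>\<box> \<phi> \<^bold>\<longrightarrow> \<^bold>\<box> \<psi>)"
| T_Box: "\<turnstile> \<^bold>\<box> \<phi> \<^bold>\<longrightarrow> \<phi>"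
| Four_Box: "\<turnstile> \<^bold>\<box> \<phi> \<^bold>\<longrightarrow> \<^bold>\<box> \<^bold>\<box> \<phi>"
| Nec_Box: "\<turnstile> \<phi> \<Longrightarrow> \<turnstile> \<^bold>\<box> \<phi>"
| KI: "\<turnstile> \<^bold>K \<phi> \<^bold>\<longrightarrow> \<^bold>\<box> \<phi>"
| K_B: "\<turnstile> \<^bold>B (\<phi> \<^bold>\<longrightarrow> \<psi>) \<^bold>\<longrightarrow> (\<^bold>B \<phi> \<^bold>\<longrightarrow> \<^bold>B \<psi>)"
| sPI: "\<turnstile> \<^bold>B \<phi> \<^bold>\<longrightarrow> \<^bold>K \<^bold>B \<phi>"
| KB: "\<turnstile> \<^bold>K \<phi> \<^bold>\<longrightarrow> \<^bold>B \<phi>"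
| RB: "\<turnstile> \<^bold>B \<phi> \<^bold>\<longrightarrow> \<^bold>B \<^bold>\<box> \<phi>"
| wF: "\<turnstile> \<^bold>B \<phi> \<^bold>\<longrightarrow> \<^bold>\<diamond> \<phi>"
| CB: "\<turnstile> \<^bold>B (\<^bold>\<box> \<phi> \<^bold>\<or> \<^bold>\<box> \<^bold>\<not> \<^bold>\<box> \<phi>)"

end

(* For the forward direction, (RB) and (wF) give B\<phi> \<rightarrow> \<diamond>\<box>\<phi>; necessitate by K and
   use (sPI). For the converse, K\<diamond>\<box>\<phi> gives B\<diamond>\<box>\<phi> by (KB), which rules out the second
   disjunct of (CB) inside B, so that B\<box>\<phi> and hence B\<phi>. *)
theory Submission
  imports Defs
begin

text \<open>Reduces propositional reasoning to a check over valuations, with modal subformulas as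
  atoms. Several premises are first joined by \<open>SEL_conj\<close>.\<close>

lemma taut_MP:
  assumes "\<turnstile> \<phi>" "\<And>v. tval v \<phi> \<Longrightarrow> tval v \<psi>"
  shows "\<turnstile> \<psi>"
proof -
  have "\<turnstile> \<phi> \<^bold>\<longrightarrow> \<psi>"
    by (rule Taut) (use assms(2) in \<open>auto simp: tautology_def\<close>)
  with assms(1) show ?thesis by (rule MP)
qed

lemma SEL_conj:
  assumes "\<turnstile> \<phi>" "\<turnstile> \<psi>"
  shows "\<turnstile> \<phi> \<^bold>\<and> \<psi>"
proof -
  have "\<turnstile> \<phi> \<^bold>\<longrightarrow> \<psi> \<^bold>\<longrightarrow> \<phi> \<^bold>\<and> \<psi>"
    by (rule Taut) (auto simp: tautology_def)
  with assms show ?thesis by (blast intro: MP)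
qed

lemma SEL_trans:
  assumes "\<turnstile> \<phi> \<^bold>\<longrightarrow> \<psi>" "\<turnstile> \<psi> \<^bold>\<longrightarrow> \<chi>"
  shows "\<turnstile> \<phi> \<^bold>\<longrightarrow> \<chi>"
  using SEL_conj[OF assms] by (rule taut_MP) auto

lemma K_mono: "\<turnstile> \<phi> \<^bold>\<longrightarrow> \<psi> \<Longrightarrow> \<turnstile> \<^bold>K \<phi> \<^bold>\<longrightarrow> \<^bold>K \<psi>"
  by (rule MP[OF Nec_K K_K])

text \<open>Necessitation for \<open>B\<close> is not a primitive rule; it comes from
  \<open>Nec_K\<close> followed by \<open>KB\<close>, after which \<open>K_B\<close>
  distributes.\<close>

lemma B_mono: "\<turnstile> \<phi> \<^bold>\<longrightarrow> \<psi> \<Longrightarrow> \<turnstile> \<^bold>B \<phi> \<^bold>\<longrightarrow> \<^bold>B \<psi>"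
  by (rule MP[OF MP[OF Nec_K KB] K_B])

lemma B_imp_K_Dia_Box: "\<turnstile> \<^bold>B \<phi> \<^bold>\<longrightarrow> \<^bold>K \<^bold>\<diamond> \<^bold>\<box> \<phi>"
  by (rule SEL_trans[OF sPI K_mono[OF SEL_trans[OF RB wF]]])

lemma K_Dia_Box_imp_B: "\<turnstile> \<^bold>K \<^bold>\<diamond> \<^bold>\<box> \<phi> \<^bold>\<longrightarrow> \<^bold>B \<phi>"
proof -
  \<comment> \<open>Disjunctive syllogism: once the diamond is unfolded, the middle formula is
    literally the negation of the second disjunct.\<close>
  have "\<turnstile> (\<^bold>\<box> \<phi> \<^bold>\<or> \<^bold>\<box> \<^bold>\<not> \<^bold>\<box> \<phi>) \<^bold>\<longrightarrow> \<^bold>\<diamond> \<^bold>\<box> \<phi> \<^bold>\<longrightarrow> \<^bold>\<box> \<phi>"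
    by (rule Taut) (auto simp: tautology_def)
  then have "\<turnstile> \<^bold>B (\<^bold>\<diamond> \<^bold>\<box> \<phi> \<^bold>\<longrightarrow> \<^bold>\<box> \<phi>)"
    by (rule MP[OF CB B_mono])
  then have "\<turnstile> \<^bold>B \<^bold>\<diamond> \<^bold>\<box> \<phi> \<^bold>\<longrightarrow> \<^bold>B \<^bold>\<box> \<phi>"
    by (rule MP[OF _ K_B])
  then show ?thesis
    \<comment> \<open>The chained implication fills the gap between \<open>KB\<close> and the
      removal of the box under \<open>B\<close>.\<close>
    by (rule SEL_trans[OF KB SEL_trans[OF _ B_mono[OF T_Box]]])
qed

theorem proposition3:
  fixes \<phi> :: "('p :: countable) fm"
  shows "\<turnstile> \<^bold>B \<phi> \<^bold>\<longleftrightarrow> \<^bold>K \<^bold>\<diamond> \<^bold>\<box> \<phi>"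
  by (rule SEL_conj[OF B_imp_K_Dia_Box K_Dia_Box_imp_B])

end
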